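(* Let $p\ge1$, let $h\in\mathbb{R}^p$ with $h_i\ne0$ for all $i\in[p]$, and let $f:\mathbb{R}\to\mathbb{R}$ be convex with $f(0)=0$. Let $Q_{\mathrm{sh}}=\{z\in\{0,1\}^p: z_p\le z_i\ \forall i\in[p-1]\}$ and $$Z_{Q_{\mathrm{sh}}}=\left\{(z,\beta,t)\in Q_{\mathrm{sh}}\times\mathbb{R}^p\times\mathbb{R}\;:\; f(h^\top\beta)\le t,\ \beta_i(1-z_i)=0\ \ \forall i\in[p]\right\}.$$ Then $\operatorname{cl\,conv}(Z_{Q_{\mathrm{sh}}})$ is the set of all $(z,\beta,t)\in[0,1]^p\times\mathbb{R}^p\times\mathbb{R}$ satisfying $$f(h^\top\beta)\le t,\qquad z_p\le z_i\ \ \forall i\in[p-1],$$ $$\Big(\sum_{i\in[p-1]}z_i-(p-2)z_p\Big)f\left(\frac{h^\top\beta}{\sum_{i\in[p-1]}z_i-(p-2)z_p}\right)\le t.$$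
   Context: Notation: $[p]=\{1,\dots,p\}$; $\operatorname{cl\,conv}$ is the closure of the convex hull. Convention for perspectives: for $w>0$ the expression $w f(x/w)$ is the usual one, and for $w=0$ it is understood as $0f(x/0):=\lim_{w\to0^+}w f(x/w)\in(-\infty,+\infty]$ (an inequality with left-hand side $+\infty$ is never satisfied by real $t$). *)

theory Defs
  imports "HOL-Analysis.Analysis"
begin

text \<open>
  Coordinates of the \<open>p\<close>-dimensional space are indexed by a finite type \<open>'n\<close>, so \<open>p = CARD('n)\<close>;
  the index written \<open>p\<close> in \<open>z\<^sub>p\<close> is a distinguished element \<open>l\<close> of \<open>'n\<close>, and \<open>[p-1]\<close> is
  \<open>UNIV - {l}\<close>.
\<close>

text \<open>
  \<open>persp f w x\<close> is \<open>w f(x/w)\<close>, extended to \<open>w = 0\<close> by the limit from the right, with values in the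
  extended reals. Negative \<open>w\<close> is never used.
\<close>

definition persp :: "(real \<Rightarrow> real) \<Rightarrow> real \<Rightarrow> real \<Rightarrow> ereal" where
  "persp f w x =
     (if w = 0 then Lim (at_right 0) (\<lambda>v. ereal (v * f (x / v))) else ereal (w * f (x / w)))"

definition Q_sh :: "'n::finite \<Rightarrow> (real ^ 'n) set" where
  "Q_sh l = {z. (\<forall>i. z $ i \<in> {0, 1}) \<and> (\<forall>i\<in>UNIV - {l}. z $ l \<le> z $ i)}"

definition Z_set ::
  "(real \<Rightarrow> real) \<Rightarrow> real ^ 'n \<Rightarrow> (real ^ 'n::finite) set \<Rightarrow>
   ((real ^ 'n) \<times> (real ^ 'n) \<times> real) set" where
  "Z_set f h Q = {(z, \<beta>, t). z \<in> Q \<and> f (h \<bullet> \<beta>) \<le> t \<and> (\<forall>i. \<beta> $ i * (1 - z $ i) = 0)}"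

text \<open>\<open>Lim\<close> is a definite description; the following shows that the limit in \<open>persp\<close> exists.\<close>

lemma persp_mono:
  fixes f :: "real \<Rightarrow> real"
  assumes "convex_on UNIV f" and "f 0 = 0" and "0 < v" and "v \<le> w"
  shows "w * f (x / w) \<le> v * f (x / v)"
proof -
  have "f ((1 - v / w) *\<^sub>R 0 + (v / w) *\<^sub>R (x / v)) \<le> (1 - v / w) * f 0 + (v / w) * f (x / v)"
    using assms by (intro convex_onD) auto
  hence "f (x / w) \<le> (v / w) * f (x / v)"
    using assms by simp
  thus ?thesis
    using assms by (simp add: field_simps)
qed

lemma persp_0_tendsto:
  fixes f :: "real \<Rightarrow> real"
  assumes "convex_on UNIV f" and "f 0 = 0"
  shows "((\<lambda>v. ereal (v * f (x / v))) \<longlongrightarrow> persp f 0 x) (at_right 0)"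
    and "persp f 0 x \<noteq> -\<infinity>"
proof -
  let ?g = "\<lambda>v. ereal (v * f (x / v))"
  let ?S = "SUP v\<in>{0<..}. ?g v"
  have lim: "(?g \<longlongrightarrow> ?S) (at_right 0)"
  proof (rule order_tendstoI)
    fix a assume "a < ?S"
    then obtain w where w: "w > 0" "a < ?g w"
      by (auto simp: less_SUP_iff)
    have "a < ?g v" if "0 < v" "v < w" for v
      using persp_mono[OF assms, of v w x] that w(2) by (meson ereal_less_eq(3) less_le_trans less_imp_le)
    thus "eventually (\<lambda>v. a < ?g v) (at_right 0)"
      using w(1) unfolding eventually_at_right_field by blast
  next
    fix a assume a: "?S < a"
    have "?g v < a" if "0 < v" for v
      using SUP_upper[of v "{0<..}" ?g] that a by (auto intro: le_less_trans)
    thus "eventually (\<lambda>v. ?g v < a) (at_right 0)"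
      by (auto simp: eventually_at_right_field intro: exI[of _ 1])
  qed
  hence eq: "persp f 0 x = ?S"
    by (simp add: persp_def tendsto_Lim)
  show "(?g \<longlongrightarrow> persp f 0 x) (at_right 0)"
    using lim eq by simp
  have "?g 1 \<le> ?S"
    by (rule SUP_upper) simp
  thus "persp f 0 x \<noteq> -\<infinity>"
    using eq by auto
qed

end

theory Submission imports Defs begin

text \<open>
  Write \<open>x = h \<bullet> \<beta>\<close> and let \<open>w\<close> be the number \<open>\<Sum>\<^bsub>i\<noteq>l\<^esub> z\<^sub>i - (p-2) z\<^sub>l = z\<^sub>l + \<Sum>\<^bsub>i\<noteq>l\<^esub> (z\<^sub>i - z\<^sub>l)\<close>,
  which is linear in \<open>z\<close>, vanishes at \<open>z = 0\<close> and is at least \<open>1\<close> at every other point of \<open>Q_sh l\<close>.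

  Validity of the inequalities. A convex function is the supremum of its affine minorants
  \<open>y \<mapsto> a y + b\<close>, so its perspective is the supremum of the linear functions \<open>a x + b w\<close>, and this
  remains true at \<open>w = 0\<close> (\<open>persp_le_iff_minorants\<close>). Both nonlinear constraints are therefore
  families of linear inequalities, and a linear inequality passes from a set to its closed convex
  hull. On \<open>Z_set f h (Q_sh l)\<close> they hold because \<open>f 0 = 0\<close> forces \<open>b \<le> 0\<close>.

  Sufficiency. Three facts are combined.
  \<^item> At a nonzero \<open>z \<in> Q_sh l\<close> some coordinate of \<open>\<beta>\<close> is free, and as \<open>h\<close> has no zero entry, every
    value of \<open>h \<bullet> \<beta>\<close> is attained there. At \<open>z = 1\<close> the whole kernel of \<open>h\<close> is available at no cost,
    so its elements are recession directions of the closed convex hull, and only \<open>h \<bullet> \<beta>\<close> matters.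
    Hence all \<open>(z, \<beta>, t)\<close> with \<open>f (h \<bullet> \<beta>) \<le> t\<close> belong to it, for \<open>z\<close> in the convex hull \<open>D\<close> of
    the nonzero points of \<open>Q_sh l\<close> (\<open>hull_nonzero_in_closure\<close>).
  \<^item> \<open>D\<close> contains every \<open>z\<close> with \<open>0 \<le> z\<^sub>l \<le> z\<^sub>i \<le> 1\<close> and \<open>w \<ge> 1\<close> (\<open>weight_ge_1_in_hull\<close>), and every
    such nonnegative \<open>z\<close> with \<open>w = 1\<close> (\<open>weight_1_in_hull\<close>).
  \<^item> If \<open>0 < w < 1\<close>, then \<open>z / w \<in> D\<close>, and mixing \<open>(z / w, \<beta> / w, f (x / w))\<close> with the origin in
    proportion \<open>w : 1 - w\<close> yields \<open>(z, \<beta>, w f (x / w))\<close>. The case \<open>w = 0\<close>, where \<open>z = 0\<close>, is a limit.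
\<close>

section \<open>Perspectives and affine minorants\<close>

lemma convex_supporting_line:
  fixes f :: "real \<Rightarrow> real"
  assumes "convex_on UNIV f"
  obtains a b where "\<And>y. a * y + b \<le> f y" and "a * x + b = f x"
proof -
  define a where "a = Inf ((\<lambda>t. (f x - f t) / (x - t)) ` ({x<..} \<inter> UNIV))"
  have "f y \<ge> f x + a * (y - x)" for y
    unfolding a_def by (rule convex_le_Inf_differential[OF assms]) auto
  then show ?thesis
    by (intro that[of a "f x - a * x"]) (auto simp: algebra_simps)
qed

lemma scaled_le_iff_minorants:
  fixes f :: "real \<Rightarrow> real"
  assumes "convex_on UNIV f" and "0 < w"
  shows "w * f (x / w) \<le> t \<longleftrightarrow> (\<forall>a b. (\<forall>y. a * y + b \<le> f y) \<longrightarrow> a * x + b * w \<le> t)"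
proof (intro iffI allI impI)
  fix a b assume le: "w * f (x / w) \<le> t" and "\<forall>y. a * y + b \<le> f y"
  then have "w * (a * (x / w) + b) \<le> w * f (x / w)"
    using assms(2) by (intro mult_left_mono) (blast, simp)
  with le show "a * x + b * w \<le> t"
    using assms(2) by (simp add: algebra_simps)
next
  assume min: "\<forall>a b. (\<forall>y. a * y + b \<le> f y) \<longrightarrow> a * x + b * w \<le> t"
  obtain a b where ab: "\<And>y. a * y + b \<le> f y" "a * (x / w) + b = f (x / w)"
    using convex_supporting_line[OF assms(1), of "x / w"] by metis
  have "w * f (x / w) = a * x + b * w"
    using assms(2) by (simp add: ab(2)[symmetric] algebra_simps)
  with min ab(1) show "w * f (x / w) \<le> t"
    by simp
qed

text \<open>
  For \<open>w = 0\<close> the bound means \<open>v f (x / v) \<le> t\<close> for all \<open>v > 0\<close>, since \<open>v f (x / v)\<close> increases as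
  \<open>v\<close> decreases to \<open>0\<close>; in \<open>a x + b v \<le> t\<close> the limit \<open>v \<rightarrow> 0\<close> is harmless.
\<close>

lemma persp_le_iff_minorants:
  fixes f :: "real \<Rightarrow> real"
  assumes cvx: "convex_on UNIV f" and f0: "f 0 = 0" and "0 \<le> w"
  shows "persp f w x \<le> ereal t \<longleftrightarrow> (\<forall>a b. (\<forall>y. a * y + b \<le> f y) \<longrightarrow> a * x + b * w \<le> t)"
proof (cases "w = 0")
  case False
  with \<open>0 \<le> w\<close> show ?thesis
    using scaled_le_iff_minorants[OF cvx, of w x t] by (simp add: persp_def)
next
  case True
  note lim = persp_0_tendsto(1)[OF cvx f0, of x]
  have pos: "eventually (\<lambda>v::real. 0 < v) (at_right 0)"
    by (simp add: eventually_at_right_less)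
  show ?thesis
    unfolding True
  proof (intro iffI allI impI)
    fix a b assume le: "persp f 0 x \<le> ereal t" and min: "\<forall>y. a * y + b \<le> f y"
    have "eventually (\<lambda>v. ereal (a * x + b * v) \<le> ereal (v * f (x / v))) (at_right 0)"
      using pos
    proof eventually_elim
      case (elim v)
      then show ?case
        using scaled_le_iff_minorants[OF cvx elim, of x "v * f (x / v)"] min by simp
    qed
    moreover have "((\<lambda>v. ereal (a * x + b * v)) \<longlongrightarrow> ereal (a * x + b * 0)) (at_right 0)"
      by (intro tendsto_intros)
    ultimately have "ereal (a * x + b * 0) \<le> persp f 0 x"
      using lim by (intro tendsto_le[OF trivial_limit_at_right_real])
    also note le
    finally show "a * x + b * 0 \<le> t"
      by simp
  next
    assume min: "\<forall>a b. (\<forall>y. a * y + b \<le> f y) \<longrightarrow> a * x + b * 0 \<le> t"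
    have "eventually (\<lambda>v. ereal (v * f (x / v)) \<le> ereal t) (at_right 0)"
      using pos
    proof eventually_elim
      case (elim v)
      have "a * x + b * v \<le> t" if ab: "\<forall>y. a * y + b \<le> f y" for a b
      proof -
        have "b \<le> 0"
          using ab[rule_format, of 0] f0 by simp
        then have "b * v \<le> 0"
          using elim by (simp add: mult_nonpos_nonneg)
        moreover have "a * x \<le> t"
          using min ab by auto
        ultimately show ?thesis
          by linarith
      qed
      then show ?case
        using scaled_le_iff_minorants[OF cvx elim, of x t] by simp
    qed
    then show "persp f 0 x \<le> ereal t"
      by (intro tendsto_upperbound[OF lim]) auto
  qed
qed

lemma scaled_le_persp_0:
  fixes f :: "real \<Rightarrow> real"
  assumes "convex_on UNIV f" and "f 0 = 0" and "0 < v" and "persp f 0 x \<le> ereal t"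
  shows "v * f (x / v) \<le> t"
  unfolding scaled_le_iff_minorants[OF assms(1,3)]
proof (intro allI impI)
  fix a b assume ab: "\<forall>y. a * y + b \<le> f y"
  have "b * v \<le> 0"
    using ab[rule_format, of 0] assms(2,3) by (simp add: mult_nonpos_nonneg)
  moreover have "a * x \<le> t"
    using assms(4) ab by (auto simp: persp_le_iff_minorants[OF assms(1,2)])
  ultimately show "a * x + b * v \<le> t"
    by linarith
qed

section \<open>Closed convex hulls\<close>

lemma linear_le_closure_convex_hull:
  fixes L :: "'a::euclidean_space \<Rightarrow> real"
  assumes "linear L" and "\<And>p. p \<in> S \<Longrightarrow> L p \<le> c" and "p \<in> closure (convex hull S)"
  shows "L p \<le> c"
proof -
  have "closed (L -` {..c})"
    using assms(1) by (intro continuous_closed_vimage linear_continuous_at) (auto simp: linear_linear)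
  moreover have "convex (L -` {..c})"
    using assms(1) by (intro convex_linear_vimage) auto
  moreover have "S \<subseteq> L -` {..c}"
    using assms(2) by auto
  ultimately have "closure (convex hull S) \<subseteq> L -` {..c}"
    by (intro closure_minimal hull_minimal)
  with assms(3) show ?thesis
    by auto
qed

text \<open>
  A direction in which one point of a closed convex set can move to infinity is a recession
  direction: \<open>c + d\<close> is the limit, as \<open>e \<rightarrow> 0\<close>, of the mixture of \<open>c\<close> and the distant point
  \<open>a + d / e\<close> with weights \<open>1 - e\<close> and \<open>e\<close>.
\<close>

lemma closed_convex_recession:
  fixes C :: "'a::real_normed_vector set"
  assumes "closed C" and "convex C" and ray: "\<And>r. 0 \<le> r \<Longrightarrow> a + r *\<^sub>R d \<in> C" and "c \<in> C"
  shows "c + d \<in> C"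
proof -
  have lim: "((\<lambda>e. (1 - e) *\<^sub>R c + e *\<^sub>R a + d) \<longlongrightarrow> (1 - 0) *\<^sub>R c + 0 *\<^sub>R a + d) (at_right (0::real))"
    by (intro tendsto_intros)
  have ev: "eventually (\<lambda>e::real. (1 - e) *\<^sub>R c + e *\<^sub>R a + d \<in> C) (at_right 0)"
    unfolding eventually_at_right_field
  proof (intro exI[of _ 1] conjI allI impI)
    fix e :: real assume e: "0 < e" "e < 1"
    have "(1 - e) *\<^sub>R c + e *\<^sub>R (a + (1 / e) *\<^sub>R d) \<in> C"
      using e ray[of "1 / e"] \<open>c \<in> C\<close> \<open>convex C\<close> by (intro convexD) auto
    then show "(1 - e) *\<^sub>R c + e *\<^sub>R a + d \<in> C"
      using e by (simp add: scaleR_add_right add.assoc)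
  qed simp
  from Lim_in_closed_set[OF \<open>closed C\<close> ev _ lim] show ?thesis
    by simp
qed

section \<open>Convex hull of the nonzero points of the indicator set\<close>

text \<open>
  The form \<open>\<Sum>\<^bsub>i\<noteq>l\<^esub> z\<^sub>i - (p-2) z\<^sub>l\<close>, arranged as a sum of terms that are nonnegative when
  \<open>0 \<le> z\<^sub>l \<le> z\<^sub>i\<close>. They are the coefficients of \<open>z\<close> in the basis of the all-ones vector and the \<open>e\<^sub>i\<close>
  with \<open>i \<noteq> l\<close>.
\<close>

definition sh_weight :: "'n::finite \<Rightarrow> real ^ 'n \<Rightarrow> real" where
  "sh_weight l z = z $ l + (\<Sum>i\<in>UNIV - {l}. z $ i - z $ l)"

lemma sh_weight_eq:
  "(\<Sum>i\<in>UNIV - {l}. z $ i) - (real CARD('n) - 2) * z $ l = sh_weight l z"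
  for z :: "real ^ 'n::finite"
proof -
  have "real (card (UNIV - {l})) = real CARD('n) - 1"
    by (simp add: card_Diff_singleton of_nat_diff)
  then show ?thesis
    unfolding sh_weight_def by (simp add: sum_subtractf algebra_simps)
qed

lemma linear_sh_weight: "linear (sh_weight l)"
  unfolding sh_weight_eq[symmetric]
  by (rule linearI) (simp_all add: sum.distrib sum_distrib_left algebra_simps)

lemma sh_weight_scaleR: "sh_weight l (c *\<^sub>R z) = c * sh_weight l z"
  using linear_cmul[OF linear_sh_weight, of l c z] by simp

lemma sh_weight_ge:
  assumes "\<forall>i\<in>UNIV - {l}. z $ l \<le> z $ i"
  shows "z $ l \<le> sh_weight l z"
proof -
  have "0 \<le> (\<Sum>i\<in>UNIV - {l}. z $ i - z $ l)"
    using assms by (intro sum_nonneg) simp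
  then show ?thesis
    by (simp add: sh_weight_def)
qed

lemma Q_sh_weight_ge_1:
  assumes "z \<in> Q_sh l" and "z \<noteq> 0"
  shows "1 \<le> sh_weight l z"
proof -
  have bin: "\<And>i. z $ i = 0 \<or> z $ i = 1" and ge: "\<forall>i\<in>UNIV - {l}. z $ l \<le> z $ i"
    using assms(1) by (auto simp: Q_sh_def)
  show ?thesis
  proof (cases "z $ l = 1")
    case True
    then show ?thesis
      using sh_weight_ge[OF ge] by simp
  next
    case False
    then have "z $ l = 0"
      using bin by blast
    obtain i where "z $ i \<noteq> 0"
      using assms(2) by (auto simp: vec_eq_iff)
    then have i: "z $ i = 1" "i \<in> UNIV - {l}"
      using bin[of i] \<open>z $ l = 0\<close> by auto
    have "z $ i - z $ l \<le> (\<Sum>i\<in>UNIV - {l}. z $ i - z $ l)"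
      using i(2) ge by (intro member_le_sum) auto
    then show ?thesis
      using i \<open>z $ l = 0\<close> by (simp add: sh_weight_def)
  qed
qed

lemma one_in_Q_sh: "1 \<in> Q_sh l - {0}"
  by (auto simp: Q_sh_def)

lemma axis_in_Q_sh:
  assumes "i \<noteq> l"
  shows "axis i 1 \<in> Q_sh l - {0}"
  using assms by (auto simp: Q_sh_def axis_def vec_eq_iff)

text \<open>
  Here \<open>z = z\<^sub>l 1 + \<Sum>\<^bsub>i\<noteq>l\<^esub> (z\<^sub>i - z\<^sub>l) e\<^sub>i\<close>, and the weight of \<open>z\<close> is the sum of the coefficients.
\<close>

lemma weight_1_in_hull:
  fixes z :: "real ^ 'n::finite"
  assumes "0 \<le> z $ l" and ge: "\<forall>i\<in>UNIV - {l}. z $ l \<le> z $ i" and "sh_weight l z = 1"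
  shows "z \<in> convex hull (Q_sh l - {0})"
proof -
  define u where "u i = (if i = l then z $ l else z $ i - z $ l)" for i
  define y where "y i = (if i = l then 1 else axis i (1::real) :: real ^ 'n)" for i
  have split: "(\<Sum>i\<in>UNIV. g i) = g l + (\<Sum>i\<in>UNIV - {l}. g i)"
    for g :: "'n \<Rightarrow> 'b::comm_monoid_add"
    by (simp add: sum.remove)
  have y: "y i \<in> convex hull (Q_sh l - {0})" for i
    using hull_inc[OF one_in_Q_sh[of l], of convex] hull_inc[OF axis_in_Q_sh[of i l], of convex]
    by (auto simp: y_def)
  have "(\<Sum>i\<in>UNIV. u i) = 1"
    using assms(3) by (simp add: split u_def sh_weight_def)
  then have "(\<Sum>i\<in>UNIV. u i *\<^sub>R y i) \<in> convex hull (Q_sh l - {0})"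
    using assms(1) ge y by (intro convex_sum convex_convex_hull) (auto simp: u_def)
  moreover have "(\<Sum>i\<in>UNIV. u i *\<^sub>R y i) = z"
  proof (subst vec_eq_iff, intro allI)
    fix j
    have "(\<Sum>i\<in>UNIV - {l}. u i *\<^sub>R y i) $ j
        = (\<Sum>i\<in>UNIV - {l}. if i = j then z $ j - z $ l else 0)"
      unfolding sum_component by (intro sum.cong) (auto simp: u_def y_def axis_def)
    then have "(\<Sum>i\<in>UNIV. u i *\<^sub>R y i) $ j
        = z $ l + (\<Sum>i\<in>UNIV - {l}. if i = j then z $ j - z $ l else 0)"
      unfolding split by (simp add: u_def y_def)
    then show "(\<Sum>i\<in>UNIV. u i *\<^sub>R y i) $ j = z $ j"
      by (simp add: sum.delta)
  qed
  ultimately show ?thesis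
    by simp
qed

text \<open>
  Replacing the coordinate \<open>i \<noteq> l\<close> by \<open>1\<close> is an affine map that preserves \<open>Q_sh l - {0}\<close>, hence its
  hull; a smaller increase of that coordinate gives a point on the segment from \<open>g\<close> to its image.
\<close>

lemma hull_raise_coordinate:
  fixes g :: "real ^ 'n::finite"
  assumes "g \<in> convex hull (Q_sh l - {0})" and "i \<noteq> l" and "g $ i \<le> c" and "c \<le> 1"
  shows "(\<chi> j. if j = i then c else g $ j) \<in> convex hull (Q_sh l - {0})"
proof -
  let ?D = "convex hull (Q_sh l - {0})"
  define R :: "real ^ 'n \<Rightarrow> real ^ 'n" where "R v = (\<chi> j. if j = i then 1 else v $ j)" for v
  have "convex {v. R v \<in> ?D}"
  proof (rule convexI)
    fix x y :: "real ^ 'n" and u v :: real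
    assume *: "x \<in> {v. R v \<in> ?D}" "y \<in> {v. R v \<in> ?D}" "0 \<le> u" "0 \<le> v" "u + v = 1"
    have "R (u *\<^sub>R x + v *\<^sub>R y) = u *\<^sub>R R x + v *\<^sub>R R y"
      using \<open>u + v = 1\<close> by (simp add: R_def vec_eq_iff)
    then show "u *\<^sub>R x + v *\<^sub>R y \<in> {v. R v \<in> ?D}"
      using * convexD[OF convex_convex_hull, of "R x" "Q_sh l - {0}" "R y" u v] by simp
  qed
  moreover have "Q_sh l - {0} \<subseteq> {v. R v \<in> ?D}"
  proof
    fix v assume "v \<in> Q_sh l - {0}"
    then have v: "\<And>j. v $ j = 0 \<or> v $ j = 1" "\<forall>j\<in>UNIV - {l}. v $ l \<le> v $ j"
      by (auto simp: Q_sh_def)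
    from v(1)[of l] have "v $ l \<le> 1"
      by auto
    with v \<open>i \<noteq> l\<close> have "R v \<in> Q_sh l - {0}"
      by (auto simp: Q_sh_def R_def vec_eq_iff)
    then show "v \<in> {v. R v \<in> ?D}"
      by (simp add: hull_inc)
  qed
  ultimately have "?D \<subseteq> {v. R v \<in> ?D}"
    by (intro hull_minimal)
  then have R: "R g \<in> ?D"
    using assms(1) by auto
  show ?thesis
  proof (cases "g $ i = 1")
    case True
    then have "(\<chi> j. if j = i then c else g $ j) = g"
      using assms(3,4) by (auto simp: vec_eq_iff)
    then show ?thesis
      using assms(1) by simp
  next
    case False
    define s where "s = (c - g $ i) / (1 - g $ i)"
    have s: "0 \<le> s" "s \<le> 1" "s * (1 - g $ i) = c - g $ i"
      using False assms(3,4) by (auto simp: s_def divide_simps)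
    have "(1 - s) *\<^sub>R g + s *\<^sub>R R g \<in> ?D"
      using R assms(1) s by (intro convexD convex_convex_hull) auto
    moreover have "(1 - s) *\<^sub>R g + s *\<^sub>R R g = (\<chi> j. if j = i then c else g $ j)"
      using s(3) by (auto simp: vec_eq_iff R_def algebra_simps)
    ultimately show ?thesis
      by simp
  qed
qed

lemma hull_raise:
  fixes v z :: "real ^ 'n::finite"
  assumes "v \<in> convex hull (Q_sh l - {0})" and "z $ l = v $ l" and "\<And>i. v $ i \<le> z $ i \<and> z $ i \<le> 1"
  shows "z \<in> convex hull (Q_sh l - {0})"
proof -
  have "(\<chi> j. if j \<in> A then z $ j else v $ j) \<in> convex hull (Q_sh l - {0})"
    if "finite A" "l \<notin> A" for A
    using that
  proof (induction A rule: finite_induct)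
    case empty
    then show ?case
      using assms(1) by simp
  next
    case (insert i A)
    let ?g = "\<chi> j. if j \<in> A then z $ j else v $ j"
    have "(\<chi> j. if j = i then z $ i else ?g $ j) \<in> convex hull (Q_sh l - {0})"
      using insert assms(3)[of i] by (intro hull_raise_coordinate) auto
    moreover have "(\<chi> j. if j = i then z $ i else ?g $ j)
        = (\<chi> j. if j \<in> insert i A then z $ j else v $ j)"
      by (simp add: vec_eq_iff)
    ultimately show ?case
      by simp
  qed
  from this[of "UNIV - {l}"] have "(\<chi> j. if j \<in> UNIV - {l} then z $ j else v $ j) \<in> convex hull (Q_sh l - {0})"
    by simp
  moreover have "(\<chi> j. if j \<in> UNIV - {l} then z $ j else v $ j) = z"
    using assms(2) by (auto simp: vec_eq_iff)
  ultimately show ?thesis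
    by simp
qed

text \<open>
  Shrinking the excesses \<open>z\<^sub>i - z\<^sub>l\<close> by a common factor produces a point of weight exactly \<open>1\<close> with
  the same coordinate \<open>l\<close>, from which \<open>z\<close> is recovered by raising the other coordinates.
\<close>

lemma weight_ge_1_in_hull:
  fixes z :: "real ^ 'n::finite"
  assumes "0 \<le> z $ l" and ge: "\<forall>i\<in>UNIV - {l}. z $ l \<le> z $ i" and le1: "\<forall>i. z $ i \<le> 1"
    and "1 \<le> sh_weight l z"
  shows "z \<in> convex hull (Q_sh l - {0})"
proof -
  define S where "S = (\<Sum>i\<in>UNIV - {l}. z $ i - z $ l)"
  define c where "c = (1 - z $ l) / S"
  have S: "1 - z $ l \<le> S" "z $ l \<le> 1"
    using assms(4) le1 by (auto simp: sh_weight_def S_def)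
  \<comment> \<open>If \<open>S = 0\<close> then \<open>z $ l = 1\<close>, and \<open>c = 0\<close> still satisfies \<open>c * S = 1 - z $ l\<close>.\<close>
  have c: "0 \<le> c" "c \<le> 1" "c * S = 1 - z $ l"
    using S by (auto simp: c_def divide_simps)
  define v where "v = (\<chi> i. z $ l + c * (z $ i - z $ l))"
  have "sh_weight l v = 1"
    using c(3) by (simp add: v_def sh_weight_def S_def sum_distrib_left)
  then have v: "v \<in> convex hull (Q_sh l - {0})"
    using assms(1) ge c(1) by (intro weight_1_in_hull) (auto simp: v_def)
  have "v $ i \<le> z $ i" for i
  proof -
    have "z $ l \<le> z $ i"
      using ge by (cases "i = l") auto
    then have "c * (z $ i - z $ l) \<le> 1 * (z $ i - z $ l)"
      using c(2) by (intro mult_right_mono) auto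
    then show ?thesis
      by (simp add: v_def)
  qed
  then show ?thesis
    using le1 by (intro hull_raise[OF v]) (auto simp: v_def)
qed

section \<open>Points of the closed convex hull\<close>

lemma zero_in_Z_set: "f 0 = 0 \<Longrightarrow> (0, 0, 0) \<in> Z_set f h (Q_sh l)"
  by (simp add: Z_set_def Q_sh_def)

lemma one_in_Z_set: "f (h \<bullet> \<beta>) \<le> t \<Longrightarrow> (1, \<beta>, t) \<in> Z_set f h (Q_sh l)"
  using one_in_Q_sh[of l] by (simp add: Z_set_def)

text \<open>
  Since \<open>f 0 = 0\<close>, the points \<open>(1, r \<kappa>, 0)\<close> and \<open>(0, 0, r s)\<close> lie in \<open>Z_set f h (Q_sh l)\<close> for all
  \<open>r \<ge> 0\<close> when \<open>h \<bullet> \<kappa> = 0\<close> and \<open>s \<ge> 0\<close>. Hence \<open>(0, \<kappa>, 0)\<close> and \<open>(0, 0, s)\<close> are recession directions.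
\<close>

lemma closure_hull_shift:
  fixes h :: "real ^ 'n::finite"
  assumes "f 0 = 0" and mem: "(z, \<beta>, t) \<in> closure (convex hull (Z_set f h (Q_sh l)))"
    and "h \<bullet> \<beta>' = h \<bullet> \<beta>" and "t \<le> t'"
  shows "(z, \<beta>', t') \<in> closure (convex hull (Z_set f h (Q_sh l)))"
proof -
  let ?C = "closure (convex hull (Z_set f h (Q_sh l)))"
  have C: "closed ?C" "convex ?C"
    by (auto intro: convex_closure)
  have Z: "p \<in> ?C" if "p \<in> Z_set f h (Q_sh l)" for p
    using that by (intro subsetD[OF closure_subset] hull_inc)
  have "(1, 0, 0) + r *\<^sub>R (0, \<beta>' - \<beta>, 0) \<in> ?C" if "0 \<le> r" for r
    using assms(1,3) by (intro Z) (simp add: one_in_Z_set inner_diff_right)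
  from closed_convex_recession[OF C this mem] have 1: "(z, \<beta>', t) \<in> ?C"
    by simp
  have "(0, 0, 0) + r *\<^sub>R (0, 0, t' - t) \<in> ?C" if "0 \<le> r" for r
    using assms(1,4) that by (intro Z) (simp add: Z_set_def Q_sh_def)
  from closed_convex_recession[OF C this 1] show ?thesis
    by simp
qed

text \<open>
  For a fixed value \<open>x\<close>, the \<open>z\<close> that occur with some \<open>\<beta>\<close> satisfying \<open>h \<bullet> \<beta> = x\<close> and with \<open>t = f x\<close>
  form a convex set, as a projection of a convex set. A nonzero \<open>z \<in> Q_sh l\<close> occurs, with a multiple
  of some unit vector as \<open>\<beta>\<close>.
\<close>

lemma hull_nonzero_in_closure:
  fixes h :: "real ^ 'n::finite"
  assumes h: "\<forall>i. h $ i \<noteq> 0" and "f 0 = 0"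
    and "z \<in> convex hull (Q_sh l - {0})" and "f (h \<bullet> \<beta>) \<le> t"
  shows "(z, \<beta>, t) \<in> closure (convex hull (Z_set f h (Q_sh l)))"
proof -
  define x where "x = h \<bullet> \<beta>"
  let ?H = "convex hull (Z_set f h (Q_sh l))"
  let ?P = "{z. \<exists>\<gamma>. h \<bullet> \<gamma> = x \<and> (z, \<gamma>, f x) \<in> ?H}"
  have "convex ?P"
  proof (rule convexI)
    fix z1 z2 and u v :: real
    assume *: "z1 \<in> ?P" "z2 \<in> ?P" "0 \<le> u" "0 \<le> v" "u + v = 1"
    then obtain g1 g2 where g: "h \<bullet> g1 = x" "(z1, g1, f x) \<in> ?H" "h \<bullet> g2 = x" "(z2, g2, f x) \<in> ?H"
      by blast
    have "u *\<^sub>R (z1, g1, f x) + v *\<^sub>R (z2, g2, f x) \<in> ?H"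
      using g * by (intro convexD convex_convex_hull) auto
    then have "(u *\<^sub>R z1 + v *\<^sub>R z2, u *\<^sub>R g1 + v *\<^sub>R g2, f x) \<in> ?H"
      using \<open>u + v = 1\<close> by (simp flip: distrib_right)
    moreover have "h \<bullet> (u *\<^sub>R g1 + v *\<^sub>R g2) = x"
      using g \<open>u + v = 1\<close> by (simp add: inner_add_right flip: distrib_right)
    ultimately show "u *\<^sub>R z1 + v *\<^sub>R z2 \<in> ?P"
      by blast
  qed
  moreover have "Q_sh l - {0} \<subseteq> ?P"
  proof
    fix q assume q: "q \<in> Q_sh l - {0}"
    then obtain i where "q $ i \<noteq> 0"
      by (auto simp: vec_eq_iff)
    then have i: "q $ i = 1"
      using q by (auto simp: Q_sh_def)
    have "h \<bullet> axis i (x / h $ i) = x"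
      using h by (simp add: inner_axis)
    moreover from this have "(q, axis i (x / h $ i), f x) \<in> Z_set f h (Q_sh l)"
      using q i by (auto simp: Z_set_def axis_def)
    ultimately show "q \<in> ?P"
      using hull_inc[of "(q, axis i (x / h $ i), f x)" "Z_set f h (Q_sh l)" convex] by blast
  qed
  ultimately have "convex hull (Q_sh l - {0}) \<subseteq> ?P"
    by (intro hull_minimal)
  then obtain \<gamma> where \<gamma>: "h \<bullet> \<gamma> = x" "(z, \<gamma>, f x) \<in> ?H"
    using assms(3) by blast
  then have "(z, \<gamma>, f x) \<in> closure ?H"
    by (intro subsetD[OF closure_subset])
  then show ?thesis
    by (rule closure_hull_shift[where f = f, OF assms(2)]) (use assms(4) \<gamma>(1) in \<open>auto simp: x_def\<close>)
qed

section \<open>The two inclusions\<close>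

lemma Z_set_minorant_le:
  fixes f :: "real \<Rightarrow> real" and h :: "real ^ 'n::finite"
  assumes "f 0 = 0" and ab: "\<forall>y. a * y + b \<le> f y" and "(z, \<beta>, t) \<in> Z_set f h (Q_sh l)"
  shows "a * (h \<bullet> \<beta>) + b * sh_weight l z \<le> t"
proof -
  have q: "z \<in> Q_sh l" and t: "f (h \<bullet> \<beta>) \<le> t" and c: "\<And>i. \<beta> $ i * (1 - z $ i) = 0"
    using assms(3) by (auto simp: Z_set_def)
  show ?thesis
  proof (cases "z = 0")
    case True
    then have "\<beta> = 0"
      using c by (simp add: vec_eq_iff)
    then show ?thesis
      using True t \<open>f 0 = 0\<close> by (simp add: sh_weight_def)
  next
    case False
    have "b \<le> 0"
      using ab[rule_format, of 0] \<open>f 0 = 0\<close> by simp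
    then have "b * sh_weight l z \<le> b * 1"
      using Q_sh_weight_ge_1[OF q False] by (intro mult_left_mono_neg)
    moreover have "a * (h \<bullet> \<beta>) + b \<le> f (h \<bullet> \<beta>)"
      using ab by blast
    ultimately show ?thesis
      using t by linarith
  qed
qed

lemma closure_hull_valid:
  fixes h :: "real ^ 'n::finite" and f :: "real \<Rightarrow> real"
  assumes cvx: "convex_on UNIV f" and f0: "f 0 = 0"
    and mem: "(z, \<beta>, t) \<in> closure (convex hull (Z_set f h (Q_sh l)))"
  shows "0 \<le> z $ i" and "z $ i \<le> 1" and "\<forall>i\<in>UNIV - {l}. z $ l \<le> z $ i"
    and "f (h \<bullet> \<beta>) \<le> t" and "persp f (sh_weight l z) (h \<bullet> \<beta>) \<le> ereal t"
proof -
  let ?Z = "Z_set f h (Q_sh l)"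
  have Z0: "0 \<le> z $ i" and Z1: "z $ i \<le> 1" and gel: "i \<noteq> l \<Longrightarrow> z $ l \<le> z $ i" and ft: "f (h \<bullet> \<beta>) \<le> t"
    if "(z, \<beta>, t) \<in> ?Z" for z \<beta> t i
  proof -
    have "z $ i = 0 \<or> z $ i = 1"
      using that by (auto simp: Z_set_def Q_sh_def)
    then show "0 \<le> z $ i" "z $ i \<le> 1"
      by auto
  qed (use that in \<open>auto simp: Z_set_def Q_sh_def\<close>)
  have valid: "L (z, \<beta>, t) \<le> c" if "linear L" "\<And>z \<beta> t. (z, \<beta>, t) \<in> ?Z \<Longrightarrow> L (z, \<beta>, t) \<le> c"
    for L :: "(real ^ 'n) \<times> (real ^ 'n) \<times> real \<Rightarrow> real" and c
    using linear_le_closure_convex_hull[OF that(1) _ mem, of c] that(2) by force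
  have nonneg: "0 \<le> z $ i" for i
  proof -
    have "linear (\<lambda>p::(real ^ 'n) \<times> (real ^ 'n) \<times> real. - (fst p $ i))"
      by (rule linearI) auto
    from valid[OF this, of 0] show ?thesis
      using Z0 by simp
  qed
  then show "0 \<le> z $ i" .
  have "linear (\<lambda>p::(real ^ 'n) \<times> (real ^ 'n) \<times> real. fst p $ i)"
    by (rule linearI) auto
  from valid[OF this, of 1] show "z $ i \<le> 1"
    using Z1 by simp
  show ge: "\<forall>i\<in>UNIV - {l}. z $ l \<le> z $ i"
  proof
    fix i assume "i \<in> UNIV - {l}"
    have "linear (\<lambda>p::(real ^ 'n) \<times> (real ^ 'n) \<times> real. fst p $ l - fst p $ i)"
      by (rule linearI) (auto simp: algebra_simps)
    from valid[OF this, of 0] show "z $ l \<le> z $ i"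
      using gel \<open>i \<in> UNIV - {l}\<close> by simp
  qed
  have "a * (h \<bullet> \<beta>) + b * 1 \<le> t" if ab: "\<forall>y. a * y + b \<le> f y" for a b
  proof -
    have "linear (\<lambda>p::(real ^ 'n) \<times> (real ^ 'n) \<times> real. a * (h \<bullet> fst (snd p)) - snd (snd p))"
      by (rule linearI) (auto simp: algebra_simps inner_add_right)
    moreover have "a * (h \<bullet> \<beta>) - t \<le> - b" if "(z, \<beta>, t) \<in> ?Z" for z \<beta> t
      using ft[OF that] ab[rule_format, of "h \<bullet> \<beta>"] by linarith
    ultimately show ?thesis
      using valid[of "\<lambda>p. a * (h \<bullet> fst (snd p)) - snd (snd p)" "- b"] by simp
  qed
  then show "f (h \<bullet> \<beta>) \<le> t"
    using scaled_le_iff_minorants[OF cvx, of 1 "h \<bullet> \<beta>" t] by simp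
  have "a * (h \<bullet> \<beta>) + b * sh_weight l z \<le> t" if ab: "\<forall>y. a * y + b \<le> f y" for a b
  proof -
    have "linear (\<lambda>p::(real ^ 'n) \<times> (real ^ 'n) \<times> real.
        a * (h \<bullet> fst (snd p)) + b * sh_weight l (fst p) - snd (snd p))"
      by (rule linearI)
        (auto simp: algebra_simps inner_add_right linear_add[OF linear_sh_weight] sh_weight_scaleR)
    moreover have "a * (h \<bullet> \<beta>) + b * sh_weight l z - t \<le> 0" if "(z, \<beta>, t) \<in> ?Z" for z \<beta> t
      using Z_set_minorant_le[where f = f, OF f0 ab that] by simp
    ultimately show ?thesis
      using valid[of "\<lambda>p. a * (h \<bullet> fst (snd p)) + b * sh_weight l (fst p) - snd (snd p)" 0] by simp
  qed
  moreover have "0 \<le> sh_weight l z"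
    using sh_weight_ge[OF ge] nonneg[of l] by linarith
  ultimately show "persp f (sh_weight l z) (h \<bullet> \<beta>) \<le> ereal t"
    by (simp add: persp_le_iff_minorants[OF cvx f0])
qed

lemma closure_hull_sufficient:
  fixes h :: "real ^ 'n::finite" and f :: "real \<Rightarrow> real"
  assumes h: "\<forall>i. h $ i \<noteq> 0" and cvx: "convex_on UNIV f" and f0: "f 0 = 0"
    and z01: "\<forall>i. 0 \<le> z $ i \<and> z $ i \<le> 1" and ft: "f (h \<bullet> \<beta>) \<le> t"
    and ge: "\<forall>i\<in>UNIV - {l}. z $ l \<le> z $ i"
    and pt: "persp f (sh_weight l z) (h \<bullet> \<beta>) \<le> ereal t"
  shows "(z, \<beta>, t) \<in> closure (convex hull (Z_set f h (Q_sh l)))"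
proof -
  let ?C = "closure (convex hull (Z_set f h (Q_sh l)))"
  define w where "w = sh_weight l z"
  have Z: "p \<in> ?C" if "p \<in> Z_set f h (Q_sh l)" for p
    using that by (intro subsetD[OF closure_subset] hull_inc)
  have scale: "(v *\<^sub>R y, v *\<^sub>R \<gamma>, v * s) \<in> ?C"
    if "(y, \<gamma>, s) \<in> ?C" "0 < v" "v < 1" for v y \<gamma> s
  proof -
    have "v *\<^sub>R (y, \<gamma>, s) + (1 - v) *\<^sub>R (0, 0, 0) \<in> ?C"
      using that Z[OF zero_in_Z_set[of f, OF f0]]
      by (intro convexD convex_closure convex_convex_hull) auto
    then show ?thesis
      by simp
  qed
  have "0 \<le> w"
    unfolding w_def using sh_weight_ge[OF ge] z01[rule_format, of l] by linarith
  then consider "1 \<le> w" | "0 < w" "w < 1" | "w = 0"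
    by linarith
  then show ?thesis
  proof cases
    case 1
    then have "z \<in> convex hull (Q_sh l - {0})"
      using z01 ge by (intro weight_ge_1_in_hull) (auto simp: w_def)
    then show ?thesis
      using h f0 ft by (intro hull_nonzero_in_closure)
  next
    case 2
    let ?x = "(h \<bullet> \<beta>) / w"
    have "(1 / w) *\<^sub>R z \<in> convex hull (Q_sh l - {0})"
    proof (rule weight_1_in_hull)
      show "sh_weight l ((1 / w) *\<^sub>R z) = 1"
        using 2 by (simp add: sh_weight_scaleR w_def)
    qed (use 2 z01 ge in \<open>auto simp: divide_right_mono\<close>)
    then have "((1 / w) *\<^sub>R z, (1 / w) *\<^sub>R \<beta>, f ?x) \<in> ?C"
      using h f0 by (intro hull_nonzero_in_closure) auto
    from scale[OF this 2] have "(z, \<beta>, w * f ?x) \<in> ?C"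
      using 2 by simp
    moreover have "w * f ?x \<le> t"
      using pt 2 by (simp add: persp_def flip: w_def)
    ultimately show ?thesis
      using closure_hull_shift[where f = f, OF f0] by blast
  next
    case 3
    have "z $ l = 0"
      using 3 sh_weight_ge[OF ge] z01 by (metis antisym w_def)
    then have "\<forall>i\<in>UNIV - {l}. z $ i = 0"
      using 3 z01 by (simp add: w_def sh_weight_def sum_nonneg_eq_0_iff)
    with \<open>z $ l = 0\<close> have "z = 0"
      by (auto simp: vec_eq_iff)
    \<comment> \<open>\<open>(0, \<beta>, t)\<close> is the limit of \<open>(v 1, \<beta>, t)\<close> as \<open>v \<rightarrow> 0\<close>.\<close>
    have "eventually (\<lambda>v::real. (v *\<^sub>R 1, \<beta>, t) \<in> ?C) (at_right 0)"
      unfolding eventually_at_right_field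
    proof (intro exI[of _ 1] conjI allI impI)
      fix v :: real assume v: "0 < v" "v < 1"
      let ?x = "(h \<bullet> \<beta>) / v"
      have "(1, (1 / v) *\<^sub>R \<beta>, f ?x) \<in> ?C"
        by (intro Z one_in_Z_set) simp
      from scale[OF this v] have "(v *\<^sub>R 1, \<beta>, v * f ?x) \<in> ?C"
        using v by simp
      moreover have "v * f ?x \<le> t"
        using pt 3 v by (intro scaled_le_persp_0[OF cvx f0]) (auto simp: w_def)
      ultimately show "(v *\<^sub>R 1, \<beta>, t) \<in> ?C"
        using closure_hull_shift[where f = f, OF f0] by blast
    qed simp
    moreover have "((\<lambda>v::real. (v *\<^sub>R 1, \<beta>, t)) \<longlongrightarrow> (0 *\<^sub>R (1 :: real ^ 'n), \<beta>, t)) (at_right 0)"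
      by (intro tendsto_Pair tendsto_scaleR tendsto_ident_at tendsto_const)
    ultimately have "(0 *\<^sub>R 1, \<beta>, t) \<in> ?C"
      by (intro Lim_in_closed_set[OF closed_closure]) auto
    then show ?thesis
      using \<open>z = 0\<close> by simp
  qed
qed

theorem proposition6:
  fixes h :: "real ^ 'n" and f :: "real \<Rightarrow> real" and l :: "'n::finite"
  assumes "\<forall>i. h $ i \<noteq> 0"
    and "convex_on UNIV f"
    and "f 0 = 0"
  shows "closure (convex hull (Z_set f h (Q_sh l))) =
    {(z, \<beta>, t).
       (\<forall>i. 0 \<le> z $ i \<and> z $ i \<le> 1) \<and>
       f (h \<bullet> \<beta>) \<le> t \<and>
       (\<forall>i\<in>UNIV - {l}. z $ l \<le> z $ i) \<and>
       persp f ((\<Sum>i\<in>UNIV - {l}. z $ i) - (real CARD('n) - 2) * z $ l) (h \<bullet> \<beta>) \<le> ereal t}"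
  unfolding sh_weight_eq
proof (intro equalityI subsetI)
  fix p assume "p \<in> closure (convex hull (Z_set f h (Q_sh l)))"
  moreover obtain z \<beta> t where "p = (z, \<beta>, t)"
    by (cases p)
  ultimately show "p \<in> {(z, \<beta>, t). (\<forall>i. 0 \<le> z $ i \<and> z $ i \<le> 1) \<and> f (h \<bullet> \<beta>) \<le> t \<and>
      (\<forall>i\<in>UNIV - {l}. z $ l \<le> z $ i) \<and> persp f (sh_weight l z) (h \<bullet> \<beta>) \<le> ereal t}"
    using closure_hull_valid[OF assms(2,3), of z \<beta> t h l] by simp
qed (use closure_hull_sufficient[OF assms] in blast)

end
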